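(* Let $(X,\lambda)$ be a connected quasi-reversible graph. Then for all $f\in S(\hat{X})$, \[\sup\{f(x)\colon x\in \hat{X}\} = \sup\{f(y)\colon y\in \partial \hat{X}\}.\]
   Context: A graph $(X,\lambda)$ is an at most countable set $X$ (vertices) with a weight function $\lambda\colon X\times X\to\mathbb{R}$ such that $\lambda\ge 0$, $\{y\colon\lambda(x,y)\ne 0\}$ is finite for every $x\in X$, and $\sum_{y\in X}\lambda(x,y)=1$ for every $x\in X$. There is a directed edge from $x$ to $y$ exactly when $\lambda(x,y)>0$; $\lambda$ need not be symmetric. The Kiselman boundary is $\partial X=\{x\in X\colon \lambda(x,x)=1\}$ and the interior is $X^\circ=X\setminus\partial X$. For $a\in X$ let $N_0(a)=\{a\}$, $N_{k+1}(a)=\{y\colon \lambda(x,y)>0\text{ for some }x\in N_k(a)\}$, and $C(a)=\bigcup_{k\ge0}N_k(a)$. The graph $X$ is connected if $C(a)=X$ for all $a\in X^\circ$. The graph is quasi-reversible if $\lambda(x,y)>0$ implies that either $\lambda(y,x)>0$ or $\lambda(y,y)=1$. A function $f\colon X\to\mathbb{R}$ is subharmonic on $X$, written $f\in S(X)$, if $f(x)\le\sum_{\zeta\in X}\lambda(x,\zeta)f(\zeta)$ for every $x\in X$. Ends: a ray is a one-way infinite sequence $\pi=x_0x_1x_2\ldots$ of pairwise distinct vertices with $\lambda(x_i,x_{i+1})>0$ for all $i\ge0$. For a finite $A\subset X$, the graph $X\setminus A$ breaks into connected components (as a graph, ignoring edge directions); $\pi$ is said to end in the component of $X\setminus A$ that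 contains infinitely many of the points of $\pi$. Two rays are equivalent if they end in the same component of $X\setminus A$ for every finite $A\subset X$. An end is an equivalence class of rays. Let $\partial_{end}X$ be the set of ends, $\hat X=X\cup\partial_{end}X$, and $\partial\hat X=\partial X\cup\partial_{end}X$. $S(\hat X)$ is the set of functions $f\colon\hat X\to\mathbb{R}$ such that $f|_X\in S(X)$ and $\limsup_{i\to\infty}f(x_i)\le f(\omega)$ for every end $\omega\in\partial_{end}X$ and every ray $\pi=x_0x_1x_2\ldots$ in $\omega$.
   Formalization: The boundary ∂X̂ is additionally assumed to be nonempty; otherwise the supremum on the right is over the empty set, as for two vertices joined by weight 1 in both directions with f = 0. *)

theory Defs
  imports "HOL-Library.Extended_Real" "HOL-Library.Countable_Set"
begin

text \<open>
  A graph is a carrier set \<open>X\<close> with a weight function that is only ever inspected on \<open>X \<times> X\<close>.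
  The sums over \<open>y \<in> X\<close> are written over the finite set of out-neighbours.
\<close>

definition out_nbrs :: "'a set \<Rightarrow> ('a \<Rightarrow> 'a \<Rightarrow> real) \<Rightarrow> 'a \<Rightarrow> 'a set" where
  "out_nbrs X lam x = {y \<in> X. lam x y \<noteq> 0}"

locale weighted_graph =
  fixes X :: "'a set" and lam :: "'a \<Rightarrow> 'a \<Rightarrow> real"
  assumes countable_vertices: "countable X"
    and weight_nonneg: "\<And>x y. x \<in> X \<Longrightarrow> y \<in> X \<Longrightarrow> 0 \<le> lam x y"
    and finite_out_nbrs: "\<And>x. x \<in> X \<Longrightarrow> finite (out_nbrs X lam x)"
    and weight_sum: "\<And>x. x \<in> X \<Longrightarrow> (\<Sum>y\<in>out_nbrs X lam x. lam x y) = 1"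

definition kiselman_boundary :: "'a set \<Rightarrow> ('a \<Rightarrow> 'a \<Rightarrow> real) \<Rightarrow> 'a set" where
  "kiselman_boundary X lam = {x \<in> X. lam x x = 1}"

definition kiselman_interior :: "'a set \<Rightarrow> ('a \<Rightarrow> 'a \<Rightarrow> real) \<Rightarrow> 'a set" where
  "kiselman_interior X lam = X - kiselman_boundary X lam"

primrec nbhd :: "'a set \<Rightarrow> ('a \<Rightarrow> 'a \<Rightarrow> real) \<Rightarrow> 'a \<Rightarrow> nat \<Rightarrow> 'a set" where
  "nbhd X lam a 0 = {a}"
| "nbhd X lam a (Suc k) = {y \<in> X. \<exists>x \<in> nbhd X lam a k. lam x y > 0}"

definition reach :: "'a set \<Rightarrow> ('a \<Rightarrow> 'a \<Rightarrow> real) \<Rightarrow> 'a \<Rightarrow> 'a set" where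
  "reach X lam a = (\<Union>k. nbhd X lam a k)"

definition graph_connected :: "'a set \<Rightarrow> ('a \<Rightarrow> 'a \<Rightarrow> real) \<Rightarrow> bool" where
  "graph_connected X lam \<longleftrightarrow> (\<forall>a \<in> kiselman_interior X lam. reach X lam a = X)"

definition quasi_reversible :: "'a set \<Rightarrow> ('a \<Rightarrow> 'a \<Rightarrow> real) \<Rightarrow> bool" where
  "quasi_reversible X lam \<longleftrightarrow>
     (\<forall>x \<in> X. \<forall>y \<in> X. lam x y > 0 \<longrightarrow> lam y x > 0 \<or> lam y y = 1)"

definition subharmonic :: "'a set \<Rightarrow> ('a \<Rightarrow> 'a \<Rightarrow> real) \<Rightarrow> ('a \<Rightarrow> real) set" where
  "subharmonic X lam = {f. \<forall>x \<in> X. f x \<le> (\<Sum>z\<in>out_nbrs X lam x. lam x z * f z)}"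

definition rays :: "'a set \<Rightarrow> ('a \<Rightarrow> 'a \<Rightarrow> real) \<Rightarrow> (nat \<Rightarrow> 'a) set" where
  "rays X lam = {p. inj p \<and> range p \<subseteq> X \<and> (\<forall>i. lam (p i) (p (Suc i)) > 0)}"

definition undirected_edges :: "'a set \<Rightarrow> ('a \<Rightarrow> 'a \<Rightarrow> real) \<Rightarrow> ('a \<times> 'a) set" where
  "undirected_edges Y lam = {(x, y) \<in> Y \<times> Y. lam x y > 0 \<or> lam y x > 0}"

text \<open>The connected components of the induced subgraph on \<open>Y\<close>, ignoring edge directions.\<close>

definition components :: "'a set \<Rightarrow> ('a \<Rightarrow> 'a \<Rightarrow> real) \<Rightarrow> 'a set set" where
  "components Y lam = Y // {(x, y) \<in> Y \<times> Y. (x, y) \<in> (undirected_edges Y lam)\<^sup>*}"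

text \<open>
  A tail of a ray avoids the finite set \<open>A\<close> and is connected, so exactly one component
  \<open>K\<close> satisfies the following.
\<close>

definition ends_in ::
  "'a set \<Rightarrow> ('a \<Rightarrow> 'a \<Rightarrow> real) \<Rightarrow> (nat \<Rightarrow> 'a) \<Rightarrow> 'a set \<Rightarrow> 'a set \<Rightarrow> bool" where
  "ends_in X lam p A K \<longleftrightarrow> K \<in> components (X - A) lam \<and> infinite (range p \<inter> K)"

definition ray_equiv :: "'a set \<Rightarrow> ('a \<Rightarrow> 'a \<Rightarrow> real) \<Rightarrow> ((nat \<Rightarrow> 'a) \<times> (nat \<Rightarrow> 'a)) set" where
  "ray_equiv X lam = {(p, q) \<in> rays X lam \<times> rays X lam.
     \<forall>A. finite A \<and> A \<subseteq> X \<longrightarrow> (\<exists>K. ends_in X lam p A K \<and> ends_in X lam q A K)}"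

definition ends :: "'a set \<Rightarrow> ('a \<Rightarrow> 'a \<Rightarrow> real) \<Rightarrow> (nat \<Rightarrow> 'a) set set" where
  "ends X lam = rays X lam // ray_equiv X lam"

text \<open>Vertices and ends are kept apart by a disjoint sum: \<open>Inl x\<close> is a vertex, \<open>Inr w\<close> an end.\<close>

definition X_hat :: "'a set \<Rightarrow> ('a \<Rightarrow> 'a \<Rightarrow> real) \<Rightarrow> ('a + (nat \<Rightarrow> 'a) set) set" where
  "X_hat X lam = X <+> ends X lam"

definition boundary_hat :: "'a set \<Rightarrow> ('a \<Rightarrow> 'a \<Rightarrow> real) \<Rightarrow> ('a + (nat \<Rightarrow> 'a) set) set" where
  "boundary_hat X lam = kiselman_boundary X lam <+> ends X lam"

text \<open>The limit superior is taken in the extended reals, since it may be infinite.\<close>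

definition subharmonic_hat ::
  "'a set \<Rightarrow> ('a \<Rightarrow> 'a \<Rightarrow> real) \<Rightarrow> ('a + (nat \<Rightarrow> 'a) set \<Rightarrow> real) set" where
  "subharmonic_hat X lam = {f. (\<lambda>x. f (Inl x)) \<in> subharmonic X lam \<and>
     (\<forall>w \<in> ends X lam. \<forall>p \<in> w. limsup (\<lambda>i. ereal (f (Inl (p i)))) \<le> ereal (f (Inr w)))}"

end

theory Submission imports Defs begin

text \<open>
  Suppose \<open>f a\<close> exceeds the supremum over the boundary, and let \<open>T\<close> be the set of vertices reached
  from \<open>a\<close> by paths along which \<open>f\<close> is nondecreasing. If \<open>T\<close> is infinite, Koenig's lemma gives a
  ray along which \<open>f \<ge> f a\<close>, so the value at its end is too large. If \<open>T\<close> is finite, a maximum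
  point of \<open>f\<close> on \<open>T\<close> is interior, and \<open>f\<close> is constant on everything reachable from it, that is on
  \<open>X = T\<close>; then there is neither an end nor a Kiselman boundary vertex.
\<close>

text \<open>Plain Koenig would give a path that may revisit points. Keeping only the edges
  \<open>E\<close> that raise the distance \<open>d\<close> from \<open>a\<close> by one loses no
  reachable point and makes every path injective.\<close>

lemma koenig_injective_path:
  assumes fin: "\<And>x. finite (R `` {x})" and inf: "infinite (R\<^sup>* `` {a})"
  obtains p where "p 0 = a" "inj p" "\<And>i. (p i, p (Suc i)) \<in> R"
proof -
  define d where "d y = (LEAST n. (a, y) \<in> R ^^ n)" for y
  define E where "E = {(x, y) \<in> R. d y = Suc (d x)}"
  have d_path: "(a, y) \<in> R ^^ d y" if "(a, y) \<in> R\<^sup>*" for y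
    using that unfolding d_def by (metis LeastI rtrancl_power)
  have d_le: "d y \<le> n" if "(a, y) \<in> R ^^ n" for y n
    using that unfolding d_def by (rule Least_le)
  have E_reach: "(a, y) \<in> E\<^sup>*" if "(a, y) \<in> R\<^sup>*" "d y = n" for y n
    using that
  proof (induction n arbitrary: y)
    case 0
    then show ?case using d_path[of y] by simp
  next
    case (Suc n)
    then obtain z where z: "(a, z) \<in> R ^^ n" "(z, y) \<in> R"
      using d_path[of y] by auto
    have az: "(a, z) \<in> R\<^sup>*" using z(1) by (metis rtrancl_power)
    \<comment> \<open>The predecessor of \<open>y\<close> on a shortest path has distance exactly
      \<open>n\<close>: a smaller one would give a path to \<open>y\<close> shorter than
      \<open>d y = Suc n\<close>.\<close>
    have "(a, y) \<in> R ^^ Suc (d z)" using d_path[OF az] z(2) by auto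
    then have "d z = n" using d_le[OF z(1)] d_le Suc.prems(2) by fastforce
    then have "(a, z) \<in> E\<^sup>*" "(z, y) \<in> E"
      using Suc.IH[OF az] z(2) Suc.prems(2) by (auto simp: E_def)
    then show ?case by (rule rtrancl_into_rtrancl)
  qed
  have "R\<^sup>* `` {a} \<subseteq> E\<^sup>* `` {a}" using E_reach by auto
  then have infE: "infinite (E\<^sup>* `` {a})" using inf finite_subset by blast
  \<comment> \<open>Otherwise the descendants of \<open>x\<close> would be \<open>x\<close> itself
    and finitely many finite sets.\<close>
  have step: "\<exists>y. infinite (E\<^sup>* `` {y}) \<and> (x, y) \<in> E" if "infinite (E\<^sup>* `` {x})" for x
  proof (rule ccontr)
    assume "\<not> ?thesis"
    moreover have "finite (E `` {x})"
      by (rule finite_subset[OF _ fin[of x]]) (auto simp: E_def)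
    ultimately have "finite ({x} \<union> (\<Union>y\<in>E `` {x}. E\<^sup>* `` {y}))" by auto
    moreover have "E\<^sup>* `` {x} \<subseteq> {x} \<union> (\<Union>y\<in>E `` {x}. E\<^sup>* `` {y})"
      by (auto elim: converse_rtranclE)
    ultimately show False using that finite_subset by blast
  qed
  \<comment> \<open>The clause \<open>n = 0 \<longrightarrow> x = a\<close> pins the start of the
    chosen sequence.\<close>
  obtain p where p: "p 0 = a" "\<And>i. (p i, p (Suc i)) \<in> E"
    using dependent_nat_choice[of "\<lambda>n x. infinite (E\<^sup>* `` {x}) \<and> (n = 0 \<longrightarrow> x = a)"
        "\<lambda>_ x y. (x, y) \<in> E"] infE step by (metis nat.distinct(1))
  have "d (p i) = d a + i" for i
    using p by (induction i) (auto simp: E_def)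
  then have "inj p" by (metis add_left_cancel injI)
  then show thesis using that p by (auto simp: E_def)
qed

text \<open>By injectivity only finitely many indices fall into \<open>A\<close>. The remaining tail
  is a connected infinite set, so it lies in the component of its first vertex
  \<open>p N\<close>.\<close>

lemma ray_ends_in:
  assumes "p \<in> rays X lam" "finite A"
  shows "\<exists>K. ends_in X lam p A K"
proof -
  have p: "inj p" "\<And>i. p i \<in> X" "\<And>i. lam (p i) (p (Suc i)) > 0"
    using assms(1) by (auto simp: rays_def)
  have "finite (p -` A)" using assms(2) p(1) by (rule finite_vimageI)
  then obtain N where "\<forall>i\<in>p -` A. i < N" by (metis finite_nat_set_iff_bounded)
  then have tail: "p i \<in> X - A" if "i \<ge> N" for i
    using that p(2) \<open>\<forall>i\<in>p -` A. i < N\<close> by (metis DiffI linorder_not_less vimageI2)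
  define U where "U = undirected_edges (X - A) lam"
  define K where "K = {(x, y) \<in> (X - A) \<times> (X - A). (x, y) \<in> U\<^sup>*} `` {p N}"
  have path: "(p N, p (N + j)) \<in> U\<^sup>*" for j
  proof (induction j)
    case (Suc j)
    have "(p (N + j), p (N + Suc j)) \<in> U"
      using tail[of "N + j"] tail[of "N + Suc j"] p(3)[of "N + j"]
      by (auto simp: U_def undirected_edges_def)
    with Suc show ?case by (rule rtrancl_into_rtrancl)
  qed simp
  have "p i \<in> K" if "i \<ge> N" for i
    using path[of "i - N"] tail that by (auto simp: K_def)
  then have "p ` {N..} \<subseteq> range p \<inter> K" by auto
  moreover have "infinite (p ` {N..})"
    using p(1) infinite_Ici by (metis finite_imageD inj_on_subset subset_UNIV)
  ultimately have "infinite (range p \<inter> K)" using finite_subset by blast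
  moreover have "K \<in> components (X - A) lam"
    unfolding components_def K_def U_def by (rule quotientI) (use tail in auto)
  ultimately show ?thesis unfolding ends_in_def by blast
qed

text \<open>The class of \<open>p\<close> contains \<open>p\<close> because \<open>ray_equiv\<close>
  is reflexive on rays, which is what \<open>ray_ends_in\<close> provides.\<close>

lemma ray_in_end:
  assumes "p \<in> rays X lam"
  obtains w where "w \<in> ends X lam" "p \<in> w"
proof
  show "ray_equiv X lam `` {p} \<in> ends X lam"
    unfolding ends_def using assms by (rule quotientI)
  show "p \<in> ray_equiv X lam `` {p}"
    using assms ray_ends_in[OF assms] by (auto simp: ray_equiv_def)
qed

lemma infinite_vertices_if_end:
  assumes "w \<in> ends X lam"
  shows "infinite X"
proof -
  obtain p where "p \<in> rays X lam"
    using assms unfolding ends_def by (elim quotientE)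
  then have "inj p" "range p \<subseteq> X" by (auto simp: rays_def)
  then show ?thesis by (metis finite_imageD finite_subset infinite_UNIV_nat)
qed

context weighted_graph
begin

text \<open>The weights sum to 1, so the weighted sum of the differences \<open>g x - g z\<close> is
  at most 0 by subharmonicity. Its terms are nonnegative, hence all vanish, and a positive weight
  forces equality.\<close>

lemma subharmonic_local_max:
  assumes "g \<in> subharmonic X lam" "x \<in> X"
    and le: "\<And>z. z \<in> X \<Longrightarrow> lam x z > 0 \<Longrightarrow> g z \<le> g x"
    and "y \<in> X" "lam x y > 0"
  shows "g y = g x"
proof -
  let ?N = "out_nbrs X lam x"
  have terms: "0 \<le> lam x z * (g x - g z)" if "z \<in> ?N" for z
    using that le[of z] weight_nonneg[OF \<open>x \<in> X\<close>, of z] by (auto simp: out_nbrs_def)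
  have "g x \<le> (\<Sum>z\<in>?N. lam x z * g z)"
    using assms(1,2) by (auto simp: subharmonic_def)
  moreover have "(\<Sum>z\<in>?N. lam x z * (g x - g z)) = g x - (\<Sum>z\<in>?N. lam x z * g z)"
    using weight_sum[OF \<open>x \<in> X\<close>]
    by (simp add: right_diff_distrib sum_subtractf flip: sum_distrib_right)
  moreover have "0 \<le> (\<Sum>z\<in>?N. lam x z * (g x - g z))"
    using terms by (rule sum_nonneg)
  ultimately have "(\<Sum>z\<in>?N. lam x z * (g x - g z)) = 0" by linarith
  then have "\<forall>z\<in>?N. lam x z * (g x - g z) = 0"
    using terms
    by (subst (asm) sum_nonneg_eq_0_iff[OF finite_out_nbrs[OF \<open>x \<in> X\<close>]])
  then show ?thesis using assms(4,5) by (auto simp: out_nbrs_def)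
qed

lemma vertex_value_le_boundary_bound:
  assumes conn: "graph_connected X lam"
    and ne: "boundary_hat X lam \<noteq> {}"
    and f: "f \<in> subharmonic_hat X lam"
    and bound: "\<And>y. y \<in> boundary_hat X lam \<Longrightarrow> ereal (f y) \<le> M"
    and "a \<in> X"
  shows "ereal (f (Inl a)) \<le> M"
proof (rule ccontr)
  define g where "g x = f (Inl x)" for x
  assume "\<not> ?thesis"
  then have above: "M < ereal (g a)" by (simp add: g_def)
  have g: "g \<in> subharmonic X lam"
    using f by (simp add: subharmonic_hat_def g_def[abs_def])
  define R where "R = {(x, y). x \<in> X \<and> y \<in> X \<and> lam x y > 0 \<and> g x \<le> g y}"
  define T where "T = R\<^sup>* `` {a}"
  have T: "x \<in> X \<and> g a \<le> g x" if "x \<in> T" for x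
  proof -
    have "(a, x) \<in> R\<^sup>*" using that by (simp add: T_def)
    then show ?thesis
      using \<open>a \<in> X\<close> by (induction rule: rtrancl_induct) (auto simp: R_def)
  qed
  have T_step: "y \<in> T" if "x \<in> T" "y \<in> X" "lam x y > 0" "g x \<le> g y" for x y
  proof -
    have "(x, y) \<in> R" using that T by (auto simp: R_def)
    then show ?thesis using that(1) by (auto simp: T_def intro: rtrancl_into_rtrancl)
  qed
  show False
  proof (cases "finite T")
    case True
    have "a \<in> T" by (simp add: T_def)
    with True obtain v where v: "v \<in> T" "\<And>x. x \<in> T \<Longrightarrow> g x \<le> g v"
      using Max_in[of "g ` T"] Max_ge[of "g ` T"] by fastforce
    \<comment> \<open>On \<open>T\<close> the values are at least \<open>g a > M\<close>, whereas
      boundary values are at most \<open>M\<close>.\<close>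
    have not_bd: "x \<notin> kiselman_boundary X lam" if "x \<in> T" for x
    proof
      assume "x \<in> kiselman_boundary X lam"
      then have "Inl x \<in> boundary_hat X lam" by (auto simp: boundary_hat_def)
      then have "ereal (g x) \<le> M" using bound by (simp add: g_def)
      moreover have "ereal (g a) \<le> ereal (g x)" using T[OF that] by simp
      ultimately show False using above by order
    qed
    \<comment> \<open>The maximal value spreads along edges without leaving \<open>T\<close>, since
      an edge between equal values is an edge of \<open>R\<close>.\<close>
    have nbhd_T: "x \<in> T \<and> g x = g v" if "x \<in> nbhd X lam v k" for x k
      using that
    proof (induction k arbitrary: x)
      case 0
      then show ?case using v(1) by simp
    next
      case (Suc k)
      then obtain z where "x \<in> X" "lam z x > 0" "z \<in> T" "g z = g v" by auto
      \<comment> \<open>If \<open>g y\<close> exceeded \<open>g z\<close>, then \<open>y\<close>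
        would lie in \<open>T\<close> with a value above the maximum \<open>g v\<close>.\<close>
      moreover have "g y \<le> g z" if "y \<in> X" "lam z y > 0" for y
        using T_step[OF \<open>z \<in> T\<close> that] v(2)[of y] \<open>g z = g v\<close> by fastforce
      ultimately have "g x = g z"
        using subharmonic_local_max[OF g] T by blast
      then show ?case
        using T_step[of z x] \<open>x \<in> X\<close> \<open>lam z x > 0\<close> \<open>z \<in> T\<close> \<open>g z = g v\<close> by simp
    qed
    have "v \<in> kiselman_interior X lam"
      using not_bd v(1) T by (auto simp: kiselman_interior_def)
    then have "reach X lam v = X" using conn by (simp add: graph_connected_def)
    then have "X \<subseteq> T" using nbhd_T by (auto simp: reach_def)
    then have "kiselman_boundary X lam = {}"
      using not_bd by (auto simp: kiselman_boundary_def)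
    moreover have "ends X lam = {}"
      using infinite_vertices_if_end finite_subset[OF \<open>X \<subseteq> T\<close> True] by blast
    ultimately show False using ne by (simp add: boundary_hat_def)
  next
    case False
    have "finite (R `` {x})" for x
    proof (cases "x \<in> X")
      case True
      show ?thesis
        by (rule finite_subset[OF _ finite_out_nbrs[OF True]]) (auto simp: R_def out_nbrs_def)
    qed (simp add: R_def)
    then obtain p where p: "p 0 = a" "inj p" "\<And>i. (p i, p (Suc i)) \<in> R"
      using koenig_injective_path[of R a] False T_def by metis
    have "p \<in> rays X lam" using p(2,3) by (auto simp: rays_def R_def)
    then obtain w where w: "w \<in> ends X lam" "p \<in> w" by (rule ray_in_end)
    have ge: "g a \<le> g (p i)" for i
    proof (induction i)
      case (Suc i)
      then show ?case using p(3)[of i] by (simp add: R_def)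
    qed (simp add: p(1))
    \<comment> \<open>The constant \<open>g a\<close> bounds \<open>g\<close> from below along the
      ray, so the limsup condition carries it over to the end \<open>w\<close>.\<close>
    have "ereal (g a) = limsup (\<lambda>i::nat. ereal (g a))"
      by (simp add: Limsup_const)
    also have "\<dots> \<le> limsup (\<lambda>i. ereal (f (Inl (p i))))"
      by (rule Limsup_mono) (use ge in \<open>simp add: g_def\<close>)
    also have "\<dots> \<le> ereal (f (Inr w))"
      using f w by (simp add: subharmonic_hat_def)
    also have "\<dots> \<le> M"
      using w(1) bound by (auto simp: boundary_hat_def)
    finally show False using above by simp
  qed
qed

end

text \<open>In \<open>ereal\<close> an empty supremum is \<open>-\<infinity>\<close>. Two vertices
  joined both ways with weight 1 have an empty boundary, and a constant function on them would break
  the equality; hence the nonemptiness assumption.\<close>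

theorem theorem2:
  fixes X :: "'a set" and lam :: "'a \<Rightarrow> 'a \<Rightarrow> real"
    and f :: "'a + (nat \<Rightarrow> 'a) set \<Rightarrow> real"
  assumes "weighted_graph X lam"
    and "graph_connected X lam"
    and "quasi_reversible X lam"
    and "boundary_hat X lam \<noteq> {}"
    and "f \<in> subharmonic_hat X lam"
  shows "(SUP x \<in> X_hat X lam. ereal (f x)) = (SUP y \<in> boundary_hat X lam. ereal (f y))"
proof (rule antisym)
  let ?M = "SUP y \<in> boundary_hat X lam. ereal (f y)"
  have bound: "ereal (f y) \<le> ?M" if "y \<in> boundary_hat X lam" for y
    using that by (rule SUP_upper)
  show "(SUP x \<in> X_hat X lam. ereal (f x)) \<le> ?M"
  proof (rule SUP_least)
    fix x
    assume "x \<in> X_hat X lam"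
    \<comment> \<open>Ends already belong to the boundary, so only vertices need the bound.\<close>
    then consider a where "a \<in> X" "x = Inl a" | "x \<in> boundary_hat X lam"
      by (auto simp: X_hat_def boundary_hat_def)
    then show "ereal (f x) \<le> ?M"
      using weighted_graph.vertex_value_le_boundary_bound[OF assms(1,2,4,5) bound] bound
      by cases auto
  qed
  have "boundary_hat X lam \<subseteq> X_hat X lam"
    by (auto simp: X_hat_def boundary_hat_def kiselman_boundary_def)
  then show "?M \<le> (SUP x \<in> X_hat X lam. ereal (f x))"
    by (rule SUP_subset_mono) simp
qed

end
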